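(* $\mathcal{IF}\subsetneq\mathcal{DF}$. That is, every inductively free arrangement is divisionally free, and there exists a divisionally free arrangement that is not inductively free.
   Context: A (central) $\ell$-arrangement $\mathcal{A}$ is a finite set of linear hyperplanes in a vector space $V$ of dimension $\ell\ge1$ over an arbitrary field $\mathbb{K}$. $L(\mathcal{A})$ is the set of all intersections of subsets of $\mathcal{A}$ (with $V$ the empty intersection). For $H\in\mathcal{A}$, the restriction is $\mathcal{A}^H=\{L\cap H\mid L\in\mathcal{A}\setminus\{H\}\}$, an arrangement in $H$. The Möbius function is given by $\mu(V)=1$, $\mu(X)=-\sum_{Y\in L(\mathcal{A}),\,X\subsetneq Y}\mu(Y)$ for $X\ne V$, and the characteristic polynomial is $\chi(\mathcal{A};t)=\sum_{X\in L(\mathcal{A})}\mu(X)t^{\dim X}$. $\emptyset_\ell$ denotes the empty $\ell$-arrangement. Inductively free arrangements: $\mathcal{IF}_\ell$ is the set of $\ell$-arrangements defined recursively by: (1) if $\ell=1,2$, all arrangements are in $\mathcal{IF}_\ell$; (2) if $\ell\ge3$, $\mathcal{A}\in\mathcal{IF}_\ell$ if $\mathcal{A}=\emptyset_\ell$, or there is $H\in\mathcal{A}$ such that $\mathcal{A}'=\mathcal{A}\setminus\{H\}\in\mathcal{IF}_\ell$, $\mathcal{A}^H\in\mathcal{IF}_{\ell-1}$ and $\chi(\mathcal{A}^H;t)\mid\chi(\mathcal{A}';t)$. Put $\mathcal{IF}=\bigcup_{\ell\ge1}\mathcal{IF}_\ell$. Divisionally free arrangements: $\mathcal{DF}_\ell$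 is the set of $\ell$-arrangements defined recursively by: (1) if $\ell=1,2$, all arrangements are in $\mathcal{DF}_\ell$; (2) if $\ell\ge3$, $\mathcal{A}\in\mathcal{DF}_\ell$ if $\mathcal{A}=\emptyset_\ell$, or there is $H\in\mathcal{A}$ such that $\chi(\mathcal{A}^H;t)\mid\chi(\mathcal{A};t)$ and $\mathcal{A}^H\in\mathcal{DF}_{\ell-1}$. Put $\mathcal{DF}=\bigcup_{\ell\ge1}\mathcal{DF}_\ell$. Both classes range over arrangements over all fields $\mathbb{K}$. *)

theory Defs
  imports
    "Jordan_Normal_Form.Missing_VectorSpace"
    "HOL-Computational_Algebra.Polynomial"
begin

text \<open>
  The classes of arrangements below range over all fields, so a field is a HOL-Algebra record
  \<open>K\<close> rather than a type of class \<^class>\<open>field\<close>, and a vector space over it is a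
  record \<open>V\<close> in the sense of the locale \<open>vectorspace\<close>.  A subspace \<open>X\<close> of \<open>V\<close> is
  represented by its carrier set; as a vector space in its own right it is
  \<open>V\<lparr>carrier := X\<rparr>\<close>.  In this way the restriction of an arrangement to \<open>H\<close> is
  literally an arrangement in \<open>H\<close>, and no coordinates are chosen.
\<close>

definition dim_of :: "'k ring \<Rightarrow> ('k, 'v) module \<Rightarrow> 'v set \<Rightarrow> nat"
  where "dim_of K V X = vectorspace.dim K (V\<lparr>carrier := X\<rparr>)"

definition hyperplane :: "'k ring \<Rightarrow> ('k, 'v) module \<Rightarrow> 'v set \<Rightarrow> bool"
  where "hyperplane K V H \<longleftrightarrow>
    VectorSpace.subspace K H V \<and> dim_of K V H + 1 = dim_of K V (carrier V)"

definition arrangement :: "'k ring \<Rightarrow> nat \<Rightarrow> ('k, 'v) module \<Rightarrow> 'v set set \<Rightarrow> bool"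
  where "arrangement K l V A \<longleftrightarrow>
    vectorspace K V \<and> vectorspace.fin_dim K V \<and> vectorspace.dim K V = l \<and> l \<ge> 1 \<and>
    finite A \<and> (\<forall>H\<in>A. hyperplane K V H)"

text \<open>Intersecting with \<^term>\<open>carrier V\<close> makes the empty intersection equal to \<open>V\<close>.\<close>

definition intersections :: "('k, 'v) module \<Rightarrow> 'v set set \<Rightarrow> 'v set set"
  where "intersections V A = (\<lambda>B. carrier V \<inter> \<Inter>B) ` Pow A"

definition restriction :: "'v set set \<Rightarrow> 'v set \<Rightarrow> 'v set set"
  where "restriction A H = (\<lambda>L. L \<inter> H) ` (A - {H})"

text \<open>
  The Moebius function of a family \<open>L\<close> of subsets of \<open>T\<close>, with \<open>T\<close> as top element.
  The value 0 for infinite \<open>L\<close> is a convention needed for termination only: the set of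
  intersections of an arrangement is finite.
\<close>

function moebius :: "'v set set \<Rightarrow> 'v set \<Rightarrow> 'v set \<Rightarrow> int"
  where "moebius L T X =
    (if infinite L then 0
     else if X = T then 1
     else - (\<Sum>Y\<in>{Y \<in> L. X \<subset> Y}. moebius L T Y))"
  by pat_completeness auto
termination
proof (relation "measure (\<lambda>(L, T, X). card {Y \<in> L. X \<subset> Y})")
  fix L :: "'v set set" and T X Y :: "'v set"
  assume "\<not> infinite L" and Y: "Y \<in> {Y \<in> L. X \<subset> Y}"
  then have "finite {Y \<in> L. X \<subset> Y}" by simp
  moreover have "{Z \<in> L. Y \<subset> Z} \<subset> {Z \<in> L. X \<subset> Z}" using Y by blast
  ultimately show "((L, T, Y), (L, T, X)) \<in> measure (\<lambda>(L, T, X). card {Y \<in> L. X \<subset> Y})"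
    by (simp add: psubset_card_mono)
qed simp

declare moebius.simps [simp del]

text \<open>
  Characteristic polynomials are monic, so divisibility of one by another
  means the same over the integers and over the rationals.
\<close>

definition char_poly_arr :: "'k ring \<Rightarrow> ('k, 'v) module \<Rightarrow> 'v set set \<Rightarrow> int poly"
  where "char_poly_arr K V A =
    (\<Sum>X\<in>intersections V A. monom (moebius (intersections V A) (carrier V) X) (dim_of K V X))"

inductive inductively_free :: "'k ring \<Rightarrow> nat \<Rightarrow> ('k, 'v) module \<Rightarrow> 'v set set \<Rightarrow> bool"
  for K :: "'k ring"
where
  low_dim: "inductively_free K l V A"
    if "arrangement K l V A" and "l = 1 \<or> l = 2"
| empty: "inductively_free K l V {}"
    if "arrangement K l V {}" and "l \<ge> 3"
| step: "inductively_free K l V A"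
    if "arrangement K l V A" and "l \<ge> 3" and "H \<in> A"
      and "inductively_free K l V (A - {H})"
      and "inductively_free K (l - 1) (V\<lparr>carrier := H\<rparr>) (restriction A H)"
      and "char_poly_arr K (V\<lparr>carrier := H\<rparr>) (restriction A H) dvd char_poly_arr K V (A - {H})"

inductive divisionally_free :: "'k ring \<Rightarrow> nat \<Rightarrow> ('k, 'v) module \<Rightarrow> 'v set set \<Rightarrow> bool"
  for K :: "'k ring"
where
  low_dim: "divisionally_free K l V A"
    if "arrangement K l V A" and "l = 1 \<or> l = 2"
| empty: "divisionally_free K l V {}"
    if "arrangement K l V {}" and "l \<ge> 3"
| step: "divisionally_free K l V A"
    if "arrangement K l V A" and "l \<ge> 3" and "H \<in> A"
      and "char_poly_arr K (V\<lparr>carrier := H\<rparr>) (restriction A H) dvd char_poly_arr K V A"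
      and "divisionally_free K (l - 1) (V\<lparr>carrier := H\<rparr>) (restriction A H)"

text \<open>
  The classes of all inductively and all divisionally free arrangements.  Their members are
  triples of a field, a vector space over it, and an arrangement in that space.  HOL has no
  quantification over types inside a formula, so the classes are indexed by the types
  \<open>'k\<close> and \<open>'v\<close> in which the carriers of the field and of the vector space live.
  The carriers may be any subsets of these types, hence all (isomorphism types of) fields and
  vector spaces of cardinality at most those of \<open>'k\<close> and \<open>'v\<close> occur.
\<close>

definition IF :: "('k ring \<times> ('k, 'v) module \<times> 'v set set) set"
  where "IF = {(K, V, A). \<exists>l\<ge>1. inductively_free K l V A}"

definition DF :: "('k ring \<times> ('k, 'v) module \<times> 'v set set) set"
  where "DF = {(K, V, A). \<exists>l\<ge>1. divisionally_free K l V A}"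

end

theory Submission
  imports Defs "HOL-Number_Theory.Residues" "HOL-Algebra.QuotRing" "HOL-Library.Countable"
begin

text \<open>
  The inclusion rests on deletion-restriction, \<open>\<chi>(A) = \<chi>(A - {H}) - \<chi>(A\<^sup>H)\<close>: a polynomial
  \<open>\<chi>(A\<^sup>H)\<close> that divides \<open>\<chi>(A - {H})\<close> also divides \<open>\<chi>(A)\<close>, so every step of an inductive
  construction is a step of a divisional one, by induction along the construction.
  Deletion-restriction itself (\<open>char_poly_deletion_restriction\<close>) is derived from Whitney's formula
  \<open>\<chi>(A) = \<Sum> (-1)^|B| t^dim(\<Inter>B)\<close>, summed over all \<open>B \<subseteq> A\<close> (\<open>char_poly_whitney\<close>), by separating
  the sets \<open>B\<close> that contain \<open>H\<close> from those that do not.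

  For strictness, consider dimension 3.  There \<open>A\<^sup>H\<close> is an arrangement of, say, \<open>m(H)\<close> lines in a
  plane; it lies in both classes, and \<open>\<chi>(A\<^sup>H) = (t - 1)(t - (m(H) - 1))\<close>.  The example
  consists of 16 planes over the field with seven elements, with
  \<open>\<chi>(A) = (t - 1)(t - 7)(t - 8)\<close>.  Two planes have \<open>m(H) = 8\<close>, and all others \<open>m(H) \<in> {5, 6, 7}\<close>.
  Restricting to a plane with \<open>m(H) = 8\<close> shows that \<open>A\<close> is divisionally free.  An inductive
  construction of \<open>A\<close> must add some \<open>H\<close> with \<open>m(H) - 1\<close> a root of \<open>\<chi>(A)\<close> as its last plane, that
  is, one of these two.  The arrangement before that step has characteristic polynomial
  \<open>(t - 1)(t - 7)^2\<close> and again \<open>m(L) \<in> {5, 6, 7}\<close> for all its planes \<open>L\<close>, so \<open>m(L) - 1\<close> is never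
  a root and the construction cannot have reached it.

  The numbers \<open>m(H)\<close> and the characteristic polynomials are computed from the normal vectors by
  testing \<open>3 \<times> 3\<close> determinants for zero (\<open>plane_Int_eq_iff\<close>, \<open>char_poly_planes\<close>).  As the field and
  the vector space are finite, both can be renamed into any infinite types.
\<close>

section \<open>Whitney's formula and deletion-restriction\<close>

lemma alternating_sum_insert:
  fixes g :: "'a set \<Rightarrow> 'b :: comm_ring_1"
  assumes "finite A" and "x \<notin> A"
  shows "(\<Sum>B\<in>Pow (insert x A). (- 1) ^ card B * g B) =
    (\<Sum>B\<in>Pow A. (- 1) ^ card B * g B) - (\<Sum>B\<in>Pow A. (- 1) ^ card B * g (insert x B))"
proof -
  have inj: "inj_on (insert x) (Pow A)"
    using assms(2) by (auto simp: inj_on_def)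
  have "(\<Sum>B\<in>insert x ` Pow A. (- 1) ^ card B * g B) =
      (\<Sum>B\<in>Pow A. (- 1) ^ card (insert x B) * g (insert x B))"
    using inj by (simp add: sum.reindex)
  also have "\<dots> = (\<Sum>B\<in>Pow A. - ((- 1) ^ card B * g (insert x B)))"
  proof (rule sum.cong[OF refl])
    fix B assume "B \<in> Pow A"
    then have "finite B" "x \<notin> B"
      using assms by (auto intro: finite_subset)
    then show "(- 1) ^ card (insert x B) * g (insert x B) = - ((- 1) ^ card B * g (insert x B))"
      by simp
  qed
  also have "\<dots> = - (\<Sum>B\<in>Pow A. (- 1) ^ card B * g (insert x B))"
    by (rule sum_negf)
  finally have *: "(\<Sum>B\<in>insert x ` Pow A. (- 1) ^ card B * g B) =
      - (\<Sum>B\<in>Pow A. (- 1) ^ card B * g (insert x B))" .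
  have "Pow A \<inter> insert x ` Pow A = {}"
    using assms(2) by auto
  then show ?thesis
    using assms(1) * by (simp add: Pow_insert sum.union_disjoint)
qed

lemma alternating_sum_absorb:
  fixes g :: "'a set \<Rightarrow> 'b :: comm_ring_1"
  assumes "finite A" and "x \<in> A"
  shows "(\<Sum>B\<in>Pow A. (- 1) ^ card B * g (insert x B)) = 0"
  using alternating_sum_insert[of "A - {x}" x "\<lambda>B. g (insert x B)"] assms
  by (simp add: insert_absorb)

text \<open>
  The signed number of sets \<open>B \<subseteq> A\<close> with a given image \<open>C\<close> is \<open>(-1)^|C|\<close>.  This is what
  makes restriction harmless: hyperplanes with the same trace on \<open>H\<close> may be identified.
\<close>

lemma alternating_sum_image:
  fixes g :: "'b set \<Rightarrow> 'c :: comm_ring_1"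
  assumes "finite A"
  shows "(\<Sum>B\<in>Pow A. (- 1) ^ card B * g (r ` B)) = (\<Sum>C\<in>Pow (r ` A). (- 1) ^ card C * g C)"
  using assms
proof (induction A arbitrary: g)
  case empty
  then show ?case by simp
next
  case (insert x A)
  have "(\<Sum>B\<in>Pow (insert x A). (- 1) ^ card B * g (r ` B)) =
      (\<Sum>C\<in>Pow (r ` A). (- 1) ^ card C * g C) -
      (\<Sum>C\<in>Pow (r ` A). (- 1) ^ card C * g (insert (r x) C))"
    using insert.hyps
    by (simp add: alternating_sum_insert insert.IH insert.IH[of "\<lambda>C. g (insert (r x) C)"])
  also have "\<dots> = (\<Sum>C\<in>Pow (r ` insert x A). (- 1) ^ card C * g C)"
  proof (cases "r x \<in> r ` A")
    case True
    then show ?thesis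
      using insert.hyps by (simp add: alternating_sum_absorb insert_absorb)
  next
    case False
    then show ?thesis
      using insert.hyps by (simp add: alternating_sum_insert)
  qed
  finally show ?case .
qed

lemma intersections_finite: "finite A \<Longrightarrow> finite (intersections V A)"
  by (simp add: intersections_def)

text \<open>
  The alternating sums on the right satisfy the recursion of the Moebius function: for \<open>X\<close>
  other than the whole space, summed over all \<open>Y \<supseteq> X\<close>, they give the alternating sum over the
  \<open>B\<close> with \<open>X \<subseteq> \<Inter>B\<close>, which vanishes because any fixed \<open>H \<supseteq> X\<close> in \<open>A\<close> can be added to or
  removed from \<open>B\<close>.
\<close>

lemma moebius_eq_alternating_sum:
  fixes V :: "('k, 'v) module"
  assumes fin: "finite A" and proper: "\<And>H. H \<in> A \<Longrightarrow> \<not> carrier V \<subseteq> H"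
    and "X \<in> intersections V A"
  shows "moebius (intersections V A) (carrier V) X =
    (\<Sum>B\<in>Pow A. (- 1) ^ card B * (if carrier V \<inter> \<Inter>B = X then 1 else 0))"
  using \<open>X \<in> intersections V A\<close>
proof (induction "card {Y \<in> intersections V A. X \<subset> Y}" arbitrary: X rule: less_induct)
  case less
  let ?L = "intersections V A" and ?T = "carrier V"
  define \<nu> :: "'v set \<Rightarrow> int" where
    "\<nu> Y = (\<Sum>B\<in>Pow A. (- 1) ^ card B * (if ?T \<inter> \<Inter>B = Y then 1 else 0))" for Y
  have finL: "finite ?L"
    using fin by (rule intersections_finite)
  show ?case
  proof (cases "X = ?T")
    case True
    have "?T \<inter> \<Inter>B = X \<longleftrightarrow> B = {}" if "B \<in> Pow A" for B
      using that proper True by blast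
    then have "\<nu> X = (\<Sum>B\<in>Pow A. if B = {} then 1 else 0)"
      unfolding \<nu>_def by (intro sum.cong) auto
    then show ?thesis
      using True fin finL by (simp add: \<nu>_def moebius.simps)
  next
    case False
    have IH: "moebius ?L ?T Y = \<nu> Y" if "Y \<in> ?L" "X \<subset> Y" for Y
    proof -
      have "{Z \<in> ?L. Y \<subset> Z} \<subset> {Z \<in> ?L. X \<subset> Z}"
        using that by blast
      then have "card {Z \<in> ?L. Y \<subset> Z} < card {Z \<in> ?L. X \<subset> Z}"
        using finL by (simp add: psubset_card_mono)
      from less.hyps[OF this that(1)] show ?thesis
        by (simp add: \<nu>_def)
    qed
    obtain B0 where B0: "B0 \<subseteq> A" "X = ?T \<inter> \<Inter>B0"
      using less.prems by (auto simp: intersections_def)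
    with False obtain H where H: "H \<in> B0" by auto
    have "(\<Sum>Y\<in>{Y \<in> ?L. X \<subseteq> Y}. \<nu> Y) =
        (\<Sum>B\<in>Pow A. (- 1) ^ card B *
          (\<Sum>Y\<in>{Y \<in> ?L. X \<subseteq> Y}. if ?T \<inter> \<Inter>B = Y then 1 else 0))"
      unfolding \<nu>_def sum_distrib_left by (rule sum.swap)
    also have "\<dots> = (\<Sum>B\<in>Pow A. (- 1) ^ card B * (if X \<subseteq> \<Inter>(insert H B) then 1 else 0))"
    proof (rule sum.cong[OF refl])
      fix B assume "B \<in> Pow A"
      then have "?T \<inter> \<Inter>B \<in> ?L" by (auto simp: intersections_def)
      moreover have "X \<subseteq> ?T \<inter> \<Inter>B \<longleftrightarrow> X \<subseteq> \<Inter>(insert H B)"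
        using B0 H by blast
      ultimately show "(- 1) ^ card B * (\<Sum>Y\<in>{Y \<in> ?L. X \<subseteq> Y}. if ?T \<inter> \<Inter>B = Y then 1 else 0)
          = ((- 1) ^ card B * (if X \<subseteq> \<Inter>(insert H B) then 1 else 0) :: int)"
        using finL by simp
    qed
    also have "\<dots> = 0"
      using fin B0 H by (intro alternating_sum_absorb) auto
    finally have "(\<Sum>Y\<in>{Y \<in> ?L. X \<subseteq> Y}. \<nu> Y) = 0" .
    moreover have "{Y \<in> ?L. X \<subseteq> Y} = insert X {Y \<in> ?L. X \<subset> Y}"
      using less.prems by auto
    ultimately have "\<nu> X + (\<Sum>Y\<in>{Y \<in> ?L. X \<subset> Y}. \<nu> Y) = 0"
      using finL by simp
    moreover have "moebius ?L ?T X = - (\<Sum>Y\<in>{Y \<in> ?L. X \<subset> Y}. \<nu> Y)"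
      using False finL IH by (subst moebius.simps) simp
    ultimately show ?thesis
      by (simp add: \<nu>_def)
  qed
qed

theorem char_poly_whitney:
  assumes fin: "finite A" and proper: "\<And>H. H \<in> A \<Longrightarrow> \<not> carrier V \<subseteq> H"
  shows "char_poly_arr K V A =
    (\<Sum>B\<in>Pow A. (- 1) ^ card B * Polynomial.monom 1 (dim_of K V (carrier V \<inter> \<Inter>B)))"
proof -
  let ?L = "intersections V A" and ?T = "carrier V"
  have finL: "finite ?L"
    using fin by (rule intersections_finite)
  have sgn: "Polynomial.monom ((- 1) ^ n * c) m = (- 1) ^ n * Polynomial.monom c m" for n m and c :: int
    by (induction n) (simp_all flip: minus_monom)
  have "char_poly_arr K V A =
      (\<Sum>X\<in>?L. \<Sum>B\<in>Pow A. (- 1) ^ card B *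
        (if ?T \<inter> \<Inter>B = X then Polynomial.monom 1 (dim_of K V X) else 0))"
    unfolding char_poly_arr_def
    by (intro sum.cong[OF refl])
      (auto simp: moebius_eq_alternating_sum[OF fin proper] monom_sum sgn intro!: sum.cong)
  also have "\<dots> = (\<Sum>B\<in>Pow A. (- 1) ^ card B *
      (\<Sum>X\<in>?L. if ?T \<inter> \<Inter>B = X then Polynomial.monom 1 (dim_of K V X) else 0))"
    unfolding sum_distrib_left by (rule sum.swap)
  also have "\<dots> = (\<Sum>B\<in>Pow A. (- 1) ^ card B * Polynomial.monom 1 (dim_of K V (?T \<inter> \<Inter>B)))"
    using finL by (intro sum.cong[OF refl]) (auto simp: intersections_def)
  finally show ?thesis .
qed

lemma dim_of_subspace [simp]: "dim_of K (V\<lparr>carrier := H\<rparr>) X = dim_of K V X"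
  by (simp add: dim_of_def)

lemma char_poly_deletion_restriction_antichain:
  assumes fin: "finite A" and H: "H \<in> A" and sub: "H \<subseteq> carrier V"
    and proper: "\<And>L. L \<in> A \<Longrightarrow> \<not> carrier V \<subseteq> L"
    and antichain: "\<And>L. L \<in> A - {H} \<Longrightarrow> \<not> H \<subseteq> L"
  shows "char_poly_arr K V A = char_poly_arr K V (A - {H}) -
    char_poly_arr K (V\<lparr>carrier := H\<rparr>) (restriction A H)"
proof -
  let ?f = "\<lambda>X. Polynomial.monom (1 :: int) (dim_of K V X)"
  have restr: "char_poly_arr K (V\<lparr>carrier := H\<rparr>) (restriction A H) =
      (\<Sum>C\<in>Pow ((\<lambda>L. L \<inter> H) ` (A - {H})). (- 1) ^ card C * ?f (H \<inter> \<Inter>C))"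
    using fin antichain
    by (subst char_poly_whitney) (auto simp: restriction_def)
  also have "\<dots> = (\<Sum>B\<in>Pow (A - {H}). (- 1) ^ card B * ?f (carrier V \<inter> \<Inter>(insert H B)))"
  proof -
    have "H \<inter> (\<Inter>L\<in>B. L \<inter> H) = carrier V \<inter> \<Inter>(insert H B)" for B
      using sub by auto
    then show ?thesis
      using fin by (subst alternating_sum_image[symmetric]) simp_all
  qed
  finally have "char_poly_arr K (V\<lparr>carrier := H\<rparr>) (restriction A H) = \<dots>" .
  moreover have "char_poly_arr K V (A - {H}) =
      (\<Sum>B\<in>Pow (A - {H}). (- 1) ^ card B * ?f (carrier V \<inter> \<Inter>B))"
    using fin proper by (intro char_poly_whitney) auto
  moreover have "char_poly_arr K V A =
      (\<Sum>B\<in>Pow (insert H (A - {H})). (- 1) ^ card B * ?f (carrier V \<inter> \<Inter>B))"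
    using fin proper H by (subst char_poly_whitney) (auto simp: insert_absorb)
  ultimately show ?thesis
    using fin alternating_sum_insert[of "A - {H}" H "\<lambda>B. ?f (carrier V \<inter> \<Inter>B)"] by simp
qed

section \<open>Dimensions of subspaces\<close>

lemma subspace_basis_exists:
  fixes K :: "'k ring" and V :: "('k, 'v) module"
  assumes vs: "vectorspace K V" and fd: "vectorspace.fin_dim K V" and W: "VectorSpace.subspace K W V"
  obtains B where "finite B" "B \<subseteq> W" "\<not> LinearCombinations.module.lin_dep K V B"
    "LinearCombinations.module.span K V B = W" "card B = dim_of K V W" "vectorspace.fin_dim K (V\<lparr>carrier := W\<rparr>)"
proof -
  interpret vectorspace K V by (rule vs)
  have sm: "submodule K W V" and WV: "W \<subseteq> carrier V"
    using W by (auto simp: VectorSpace.subspace_def submodule_def)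
  interpret W: vectorspace K "vs W"
    by (rule subspace_is_vs[OF W])
  have li: "W.lin_dep S = lin_dep S" and sp: "W.span S = span S" if "S \<subseteq> W" for S
    using span_li_not_depend[OF that sm] by simp_all
  have "lin_indpt {}"
    by (simp add: lin_dep_def)
  moreover have "finite S \<and> card S \<le> dim" if "S \<subseteq> W \<and> lin_indpt S" for S
    using li_le_dim[OF fd] that WV by blast
  ultimately obtain B where B: "finite B" "maximal B (\<lambda>S. S \<subseteq> W \<and> lin_indpt S)"
    using maximal_exists[of "\<lambda>S. S \<subseteq> W \<and> lin_indpt S" dim "{}"] by auto
  then have "maximal B (\<lambda>S. S \<subseteq> carrier (vs W) \<and> W.lin_indpt S)"
    using li by (simp add: maximal_def) blast
  then have bas: "W.basis B"
    by (rule W.max_li_is_basis)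
  then have "B \<subseteq> W"
    by (simp add: W.basis_def)
  moreover have "W.fin_dim"
    using bas \<open>finite B\<close> by (auto simp: W.basis_def W.fin_dim_def)
  moreover have "card B = dim_of K V W"
    using W.dim_basis[OF \<open>finite B\<close> bas] by (simp add: dim_of_def)
  ultimately show thesis
    using that bas \<open>finite B\<close> li sp by (simp add: W.basis_def)
qed

lemma subspace_eq_of_dim_eq:
  fixes K :: "'k ring" and V :: "('k, 'v) module"
  assumes vs: "vectorspace K V" and fd: "vectorspace.fin_dim K V" and H: "VectorSpace.subspace K H V" and L: "VectorSpace.subspace K L V"
    and "H \<subseteq> L" and dim: "dim_of K V H = dim_of K V L"
  shows "H = L"
proof -
  interpret vectorspace K V by (rule vs)
  have sm: "submodule K L V"
    using L by (simp add: VectorSpace.subspace_def)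
  interpret L: vectorspace K "vs L"
    by (rule subspace_is_vs[OF L])
  obtain B where B: "finite B" "B \<subseteq> H" "lin_indpt B" "span B = H" "card B = dim_of K V H"
    using subspace_basis_exists[OF vs fd H] by metis
  have "L.fin_dim"
    using subspace_basis_exists[OF vs fd L] by metis
  moreover have BL: "B \<subseteq> L"
    using B \<open>H \<subseteq> L\<close> by auto
  ultimately have "L.basis B"
    using B dim span_li_not_depend[OF BL sm]
    by (intro L.dim_li_is_basis) (simp_all add: dim_of_def)
  then show ?thesis
    using B span_li_not_depend[OF BL sm] by (simp add: L.basis_def)
qed

lemma subspace_Int:
  assumes "vectorspace K V" and "VectorSpace.subspace K L V" and "VectorSpace.subspace K H V"
  shows "VectorSpace.subspace K (L \<inter> H) V"
  using assms by (auto simp: VectorSpace.subspace_def submodule_def)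

lemma subspace_dim_0:
  assumes "vectorspace K V" and "vectorspace.fin_dim K V" and "VectorSpace.subspace K W V"
    and "dim_of K V W = 0"
  shows "W = {\<zero>\<^bsub>V\<^esub>}"
proof -
  interpret vectorspace K V by fact
  show ?thesis
    using subspace_basis_exists[OF assms(1-3)] assms(4) span_empty by (metis card_0_eq)
qed

text \<open>A proper subspace that together with one further vector spans \<open>V\<close> has codimension 1.\<close>

lemma dim_of_codim1:
  fixes K :: "'k ring" and V :: "('k, 'v) module"
  assumes vs: "vectorspace K V" and fd: "vectorspace.fin_dim K V"
    and W: "VectorSpace.subspace K W V" and v: "v \<in> carrier V" "v \<notin> W"
    and decomp: "\<And>w. w \<in> carrier V \<Longrightarrow> \<exists>c\<in>carrier K. \<exists>u\<in>W. w = c \<odot>\<^bsub>V\<^esub> v \<oplus>\<^bsub>V\<^esub> u"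
  shows "dim_of K V W + 1 = vectorspace.dim K V"
proof -
  interpret vectorspace K V by (rule vs)
  have WV: "W \<subseteq> carrier V"
    using W by (simp add: VectorSpace.subspace_def submodule_def)
  obtain B where B: "finite B" "B \<subseteq> W" "lin_indpt B" "span B = W" "card B = dim_of K V W"
    using subspace_basis_exists[OF vs fd W] by metis
  have vB: "lin_indpt (B \<union> {v})" "v \<notin> B"
    using lin_dep_iff_in_span[of B v] B v WV by auto
  have BvV: "B \<union> {v} \<subseteq> carrier V"
    using B WV v by auto
  have "carrier V \<subseteq> span (B \<union> {v})"
  proof
    fix w assume "w \<in> carrier V"
    then obtain c u where cu: "c \<in> carrier K" "u \<in> W" "w = c \<odot>\<^bsub>V\<^esub> v \<oplus>\<^bsub>V\<^esub> u"
      using decomp by blast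
    have "u \<in> span (B \<union> {v})"
      using B cu span_is_monotone[of B "B \<union> {v}"] by auto
    moreover have "v \<in> span (B \<union> {v})"
      using in_own_span[OF BvV] by auto
    moreover have "submodule K (span (B \<union> {v})) V"
      by (rule span_is_submodule[OF BvV])
    ultimately show "w \<in> span (B \<union> {v})"
      using cu unfolding submodule_def by auto
  qed
  then have "basis (B \<union> {v})"
    using vB BvV span_is_subset2[OF BvV] by (auto simp: basis_def)
  then show ?thesis
    using dim_basis[of "B \<union> {v}"] B vB by simp
qed

lemma hyperplane_decomposition:
  fixes K :: "'k ring" and V :: "('k, 'v) module"
  assumes vs: "vectorspace K V" and fd: "vectorspace.fin_dim K V" and L: "hyperplane K V L"
    and v: "v \<in> carrier V" "v \<notin> L" and w: "w \<in> carrier V"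
  obtains c u where "c \<in> carrier K" "u \<in> L" "w = c \<odot>\<^bsub>V\<^esub> v \<oplus>\<^bsub>V\<^esub> u"
proof -
  interpret vectorspace K V by (rule vs)
  have sL: "VectorSpace.subspace K L V" and dimL: "dim_of K V L + 1 = dim"
    using L by (simp_all add: hyperplane_def dim_of_def)
  then have LV: "L \<subseteq> carrier V"
    by (simp add: VectorSpace.subspace_def submodule_def)
  obtain C where C: "finite C" "C \<subseteq> L" "lin_indpt C" "span C = L" "card C = dim_of K V L"
    using subspace_basis_exists[OF vs fd sL] by metis
  have "lin_indpt (C \<union> {v})" "v \<notin> C"
    using lin_dep_iff_in_span[of C v] C v LV by auto
  then have "basis (C \<union> {v})"
    using C dimL LV v by (intro dim_li_is_basis[OF fd]) auto
  then have "w \<in> span (C \<union> {v})"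
    using w by (simp add: basis_def)
  then obtain a where a: "a \<in> C \<union> {v} \<rightarrow> carrier K" "lincomb a (C \<union> {v}) = w"
    using finite_in_span[of "C \<union> {v}" w] C LV v by auto
  show thesis
  proof (rule that)
    show "a v \<in> carrier K"
      using a by auto
    show "lincomb a C \<in> L"
      using a C finite_span[of C] LV by auto
    show "w = a v \<odot>\<^bsub>V\<^esub> v \<oplus>\<^bsub>V\<^esub> lincomb a C"
      using lincomb_insert[of C a v] a C LV v \<open>v \<notin> C\<close> by auto
  qed
qed

lemma subspace_Int_in_subspace:
  assumes "vectorspace K V" and "VectorSpace.subspace K L V" and "VectorSpace.subspace K H V"
  shows "VectorSpace.subspace K (L \<inter> H) (V\<lparr>carrier := H\<rparr>)"
  using assms vectorspace.subspace_is_vs[OF assms(1,3)]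
  by (auto simp: VectorSpace.subspace_def submodule_def vectorspace_def)

lemma dim_of_Int_hyperplane:
  fixes K :: "'k ring" and V :: "('k, 'v) module"
  assumes vs: "vectorspace K V" and fd: "vectorspace.fin_dim K V" and L: "hyperplane K V L"
    and H: "VectorSpace.subspace K H V" and "\<not> H \<subseteq> L"
  shows "dim_of K V (L \<inter> H) + 1 = dim_of K V H"
proof -
  interpret vectorspace K V by (rule vs)
  have sL: "VectorSpace.subspace K L V"
    using L by (simp add: hyperplane_def)
  have smH: "submodule K H V" and HV: "H \<subseteq> carrier V" and LV: "L \<subseteq> carrier V"
    using H sL by (simp_all add: VectorSpace.subspace_def submodule_def)
  obtain v where v: "v \<in> H" "v \<notin> L"
    using \<open>\<not> H \<subseteq> L\<close> by auto
  have decomp: "\<exists>c\<in>carrier K. \<exists>u\<in>L \<inter> H. w = c \<odot>\<^bsub>V\<^esub> v \<oplus>\<^bsub>V\<^esub> u" if w: "w \<in> H" for w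
  proof -
    obtain c u where cu: "c \<in> carrier K" "u \<in> L" "w = c \<odot>\<^bsub>V\<^esub> v \<oplus>\<^bsub>V\<^esub> u"
      using hyperplane_decomposition[OF vs fd L, of v w] v w HV by auto
    have "c \<odot>\<^bsub>V\<^esub> v \<in> H"
      using smH v cu by (auto simp: submodule_def)
    then have "\<ominus>\<^bsub>V\<^esub> (c \<odot>\<^bsub>V\<^esub> v) \<in> H"
      using submodule.smult_closed[OF smH, of "\<ominus>\<^bsub>K\<^esub> \<one>\<^bsub>K\<^esub>" "c \<odot>\<^bsub>V\<^esub> v"] HV
      by (auto simp: smult_l_minus)
    then have "\<ominus>\<^bsub>V\<^esub> (c \<odot>\<^bsub>V\<^esub> v) \<oplus>\<^bsub>V\<^esub> w \<in> H"
      using smH w by (auto simp: submodule_def)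
    moreover have "\<ominus>\<^bsub>V\<^esub> (c \<odot>\<^bsub>V\<^esub> v) \<oplus>\<^bsub>V\<^esub> w = u"
      unfolding cu(3) using cu(1,2) v HV LV by (intro M.r_neg1 smult_closed) auto
    ultimately show ?thesis
      using cu by auto
  qed
  have "vectorspace.fin_dim K (vs H)"
    using subspace_basis_exists[OF vs fd H] by metis
  from dim_of_codim1[OF subspace_is_vs[OF H] this subspace_Int_in_subspace[OF vs sL H], of v]
  show ?thesis
    using v decomp by (simp add: dim_of_def)
qed

section \<open>Restricted arrangements\<close>

lemma arrangement_subspace:
  assumes "arrangement K l V A" and "H \<in> A"
  shows "VectorSpace.subspace K H V" "H \<subseteq> carrier V" "dim_of K V H = l - 1"
  using assms by (auto simp: arrangement_def hyperplane_def VectorSpace.subspace_def submodule_def dim_of_def)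

lemma hyperplane_not_supset:
  assumes "arrangement K l V A" and "H \<in> A"
  shows "\<not> carrier V \<subseteq> H"
proof
  assume "carrier V \<subseteq> H"
  then have "H = carrier V"
    using arrangement_subspace[OF assms] by auto
  then show False
    using assms by (auto simp: arrangement_def hyperplane_def)
qed

lemma hyperplanes_antichain:
  assumes arr: "arrangement K l V A" and "H \<in> A" and "L \<in> A" and "H \<subseteq> L"
  shows "H = L"
  using arr arrangement_subspace[OF arr \<open>H \<in> A\<close>] arrangement_subspace[OF arr \<open>L \<in> A\<close>] \<open>H \<subseteq> L\<close>
  by (intro subspace_eq_of_dim_eq[of K V H L]) (auto simp: arrangement_def)

theorem char_poly_deletion_restriction:
  assumes arr: "arrangement K l V A" and H: "H \<in> A"
  shows "char_poly_arr K V A = char_poly_arr K V (A - {H}) -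
    char_poly_arr K (V\<lparr>carrier := H\<rparr>) (restriction A H)"
proof (rule char_poly_deletion_restriction_antichain[OF _ H])
  show "finite A" using arr by (simp add: arrangement_def)
qed (use arrangement_subspace[OF arr H] hyperplane_not_supset[OF arr]
  hyperplanes_antichain[OF arr H] in auto)

lemma arrangement_Diff: "arrangement K l V A \<Longrightarrow> arrangement K l V (A - B)"
  by (auto simp: arrangement_def)

lemma arrangement_restriction:
  assumes arr: "arrangement K l V A" and H: "H \<in> A" and "l \<ge> 2"
  shows "arrangement K (l - 1) (V\<lparr>carrier := H\<rparr>) (restriction A H)"
proof -
  let ?VH = "V\<lparr>carrier := H\<rparr>"
  have vs: "vectorspace K V" and fd: "vectorspace.fin_dim K V" and fin: "finite A"
    using arr by (auto simp: arrangement_def)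
  have sH: "VectorSpace.subspace K H V"
    using arrangement_subspace[OF arr H] by auto
  have vsH: "vectorspace K ?VH"
    by (rule vectorspace.subspace_is_vs[OF vs sH])
  have fdH: "vectorspace.fin_dim K ?VH"
    using subspace_basis_exists[OF vs fd sH] by metis
  have dimH: "vectorspace.dim K ?VH = l - 1"
    using arrangement_subspace(3)[OF arr H] by (simp add: dim_of_def)
  have "hyperplane K ?VH (L \<inter> H)" if L: "L \<in> A - {H}" for L
  proof -
    have LV: "hyperplane K V L" and "\<not> H \<subseteq> L"
      using arr L H hyperplanes_antichain[OF arr H] by (auto simp: arrangement_def)
    then have "dim_of K V (L \<inter> H) + 1 = dim_of K V H"
      by (intro dim_of_Int_hyperplane[OF vs fd _ sH])
    moreover have "VectorSpace.subspace K (L \<inter> H) ?VH"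
      using LV by (intro subspace_Int_in_subspace[OF vs _ sH]) (simp add: hyperplane_def)
    ultimately show ?thesis
      by (simp add: hyperplane_def)
  qed
  then show ?thesis
    using vsH fdH dimH fin \<open>l \<ge> 2\<close> by (auto simp: arrangement_def restriction_def)
qed

section \<open>Inductively free arrangements are divisionally free\<close>

theorem divisionally_free_of_inductively_free:
  "inductively_free K l V A \<Longrightarrow> divisionally_free K l V A"
proof (induction rule: inductively_free.induct)
  case (low_dim l V A)
  then show ?case by (rule divisionally_free.low_dim)
next
  case (empty l V)
  then show ?case by (rule divisionally_free.empty)
next
  case (step l V A H)
  have "char_poly_arr K (V\<lparr>carrier := H\<rparr>) (restriction A H) dvd char_poly_arr K V A"
    using step.hyps char_poly_deletion_restriction[OF step.hyps(1,3)] by simp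
  then show ?case
    using step by (intro divisionally_free.step[of K l V A H])
qed

lemma IF_subset_DF: "IF \<subseteq> DF"
  using divisionally_free_of_inductively_free by (fastforce simp: IF_def DF_def)

section \<open>Characteristic polynomials in low dimension\<close>

lemma char_poly_empty:
  assumes "arrangement K l V {}"
  shows "char_poly_arr K V {} = Polynomial.monom 1 l"
proof -
  have "dim_of K V (carrier V) = l"
    using assms by (simp add: dim_of_def arrangement_def)
  then show ?thesis
    by (subst char_poly_whitney) auto
qed

lemma char_poly_singleton:
  assumes arr: "arrangement K l V {H}"
  shows "char_poly_arr K V {H} = Polynomial.monom 1 l - Polynomial.monom 1 (l - 1)"
proof -
  have "char_poly_arr K (V\<lparr>carrier := H\<rparr>) {} = Polynomial.monom 1 (l - 1)"
    using arrangement_subspace(3)[OF arr, of H]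
    by (subst char_poly_whitney) auto
  moreover have "char_poly_arr K V {} = Polynomial.monom 1 l"
    using arrangement_Diff[OF arr, of "{H}"] by (intro char_poly_empty) simp
  ultimately show ?thesis
    using char_poly_deletion_restriction[OF arr, of H] by (simp add: restriction_def)
qed

text \<open>
  Adding a line to a nonempty arrangement of lines in a plane changes the characteristic
  polynomial by \<open>-(t - 1)\<close>, since the restriction to the new line is the one-point arrangement.
\<close>

lemma char_poly_dim2:
  assumes "arrangement K 2 V A" and "A \<noteq> {}"
  shows "char_poly_arr K V A = [:int (card A) - 1, - int (card A), 1:]"
proof -
  have "finite A"
    using assms by (simp add: arrangement_def)
  then show ?thesis
    using \<open>A \<noteq> {}\<close> assms(1)
  proof (induction A rule: finite_ne_induct)
    case (singleton H)
    then show ?case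
      by (simp add: char_poly_singleton monom_altdef numeral_eq_Suc)
  next
    case (insert H A)
    let ?VH = "V\<lparr>carrier := H\<rparr>"
    have arrA: "arrangement K 2 V A"
      using insert.prems by (auto simp: arrangement_def)
    have arrH: "arrangement K 1 ?VH (restriction (insert H A) H)"
      using arrangement_restriction[OF insert.prems, of H] by simp
    have "X = {\<zero>\<^bsub>V\<^esub>}" if "X \<in> restriction (insert H A) H" for X
      using subspace_dim_0[of K ?VH X] arrangement_subspace[OF arrH that] arrH
      by (simp add: arrangement_def)
    moreover have "restriction (insert H A) H \<noteq> {}"
      using insert.hyps by (auto simp: restriction_def)
    ultimately have "restriction (insert H A) H = {{\<zero>\<^bsub>V\<^esub>}}"
      by auto
    then have "char_poly_arr K ?VH (restriction (insert H A) H) = [:-1, 1:]"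
      using arrH char_poly_singleton[of K 1 ?VH "{\<zero>\<^bsub>V\<^esub>}"]
      by (simp add: monom_altdef)
    then show ?case
      using char_poly_deletion_restriction[OF insert.prems, of H] insert.hyps insert.IH[OF arrA]
      by simp
  qed
qed

lemma char_poly_dim3_restriction:
  assumes "arrangement K 3 V A" and "H \<in> A" and "restriction A H \<noteq> {}"
  shows "char_poly_arr K (V\<lparr>carrier := H\<rparr>) (restriction A H) =
    [:int (card (restriction A H)) - 1, - int (card (restriction A H)), 1:]"
  using arrangement_restriction[OF assms(1,2)] assms(3) by (intro char_poly_dim2) simp_all

lemma inductively_free_arrangement: "inductively_free K l V A \<Longrightarrow> arrangement K l V A"
  by (induction rule: inductively_free.induct)

text \<open>
  In dimension 3 the restriction to \<open>H\<close> has characteristic polynomial \<open>(t - 1)(t - (m - 1))\<close>,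
  where \<open>m\<close> is its number of lines.  By deletion-restriction it divides the characteristic
  polynomial of \<open>A\<close> if it divides that of \<open>A - {H}\<close>; then \<open>m - 1\<close> is a root of \<open>\<chi>(A)\<close>.  At least
  two planes are required because \<open>\<chi>(A\<^sup>H) = t^2\<close> when \<open>A = {H}\<close>.
\<close>

lemma inductively_free_dim3_root:
  assumes "inductively_free K 3 V A" and "card A \<ge> 2"
  obtains H where "H \<in> A" and "inductively_free K 3 V (A - {H})"
    and "poly (char_poly_arr K V A) (int (card (restriction A H)) - 1) = 0"
  using assms(1)
proof cases
  case (step H)
  let ?m = "int (card (restriction A H))"
  have "A \<noteq> {H}"
    using assms(2) by auto
  then have "restriction A H \<noteq> {}"
    using step by (auto simp: restriction_def)
  then have chi: "char_poly_arr K (V\<lparr>carrier := H\<rparr>) (restriction A H) = [:?m - 1, - ?m, 1:]"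
    using step by (intro char_poly_dim3_restriction) auto
  have "char_poly_arr K (V\<lparr>carrier := H\<rparr>) (restriction A H) dvd char_poly_arr K V A"
    using step char_poly_deletion_restriction[of K 3 V A H] by simp
  moreover have "poly [:?m - 1, - ?m, 1:] (?m - 1) = 0"
    by (simp add: algebra_simps)
  ultimately have "poly (char_poly_arr K V A) (?m - 1) = 0"
    by (metis chi dvdE mult_zero_left poly_mult)
  with step show ?thesis by (intro that)
qed (use assms(2) in auto)

section \<open>Three-dimensional space over the field with seven elements\<close>

text \<open>
  Vectors over the field with seven elements are triples of integers in \<open>{0..6}\<close>.  The operations
  below are those of integer vectors, and \<open>mod7\<close> reduces their results to such triples.
\<close>

type_synonym vec3 = "int \<times> int \<times> int"

fun dot :: "vec3 \<Rightarrow> vec3 \<Rightarrow> int" where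
  "dot (a, b, c) (x, y, z) = a * x + b * y + c * z"

fun cross :: "vec3 \<Rightarrow> vec3 \<Rightarrow> vec3" where
  "cross (a, b, c) (x, y, z) = (b * z - c * y, c * x - a * z, a * y - b * x)"

fun scale :: "int \<Rightarrow> vec3 \<Rightarrow> vec3" where
  "scale k (x, y, z) = (k * x, k * y, k * z)"

fun plus3 :: "vec3 \<Rightarrow> vec3 \<Rightarrow> vec3" where
  "plus3 (a, b, c) (x, y, z) = (a + x, b + y, c + z)"

fun mod7 :: "vec3 \<Rightarrow> vec3" where
  "mod7 (x, y, z) = (x mod 7, y mod 7, z mod 7)"

lemma dot_plus3: "dot n (plus3 u v) = dot n u + dot n v"
  by (cases n; cases u; cases v) (simp add: algebra_simps)

lemma dot_scale: "dot n (scale k v) = k * dot n v"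
  by (cases n; cases v) (simp add: algebra_simps)

lemma dot_mod7: "dot n (mod7 v) mod 7 = dot n v mod 7"
proof (cases n; cases v)
  fix a b c x y z
  assume "n = (a, b, c)" "v = (x, y, z)"
  moreover have "[a * (x mod 7) + b * (y mod 7) + c * (z mod 7) = a * x + b * y + c * z] (mod 7)"
    by (intro cong_add cong_mult cong_refl) (simp_all add: cong_def)
  ultimately show ?thesis by (simp add: cong_def)
qed

lemma dot_cross_self: "dot n (cross n m) = 0" "dot m (cross n m) = 0"
  by (cases n; cases m; simp add: algebra_simps)+

definition F7 :: "int set" where "F7 = {0..6}"

abbreviation F7_3 :: "vec3 set" where "F7_3 \<equiv> F7 \<times> F7 \<times> F7"

lemma mod7_F7 [simp]: "x mod 7 \<in> F7"
  using pos_mod_bound[of 7 x] by (simp add: F7_def)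

lemma F7_mod [simp]: "x \<in> F7 \<Longrightarrow> x mod 7 = x"
  by (simp add: F7_def)

lemma F7_dvd [simp]: "x \<in> F7 \<Longrightarrow> 7 dvd x \<longleftrightarrow> x = 0"
  by (metis F7_mod dvd_0_right mod_0_imp_dvd dvd_imp_mod_0)

lemma zero_one_in_F7 [simp]: "0 \<in> F7" "1 \<in> F7"
  by (simp_all add: F7_def)

lemma F7_cancel: "x \<in> F7 \<Longrightarrow> (x + k mod 7 - k) mod 7 = x"
  unfolding F7_def by simp presburger

lemma mod7_in [simp]: "mod7 v \<in> F7_3"
  by (cases v) simp

lemma mod7_id [simp]: "v \<in> F7_3 \<Longrightarrow> mod7 v = v"
  by (cases v) auto

text \<open>
  The three-dimensional space over the field with seven elements, with scalars and vectors
  renamed by injections \<open>\<phi>\<close> and \<open>\<psi>\<close> into arbitrary types; \<open>\<phi>'\<close> and \<open>\<psi>'\<close> are left inverses.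
\<close>

locale F7_space =
  fixes \<phi> :: "int \<Rightarrow> 'k" and \<phi>' :: "'k \<Rightarrow> int"
    and \<psi> :: "vec3 \<Rightarrow> 'v" and \<psi>' :: "'v \<Rightarrow> vec3"
  assumes \<phi>'_\<phi> [simp]: "\<phi>' (\<phi> a) = a" and \<psi>'_\<psi> [simp]: "\<psi>' (\<psi> v) = v"
begin

definition K :: "'k ring" where
  "K = \<lparr>carrier = \<phi> ` F7,
     monoid.mult = \<lambda>a b. \<phi> ((\<phi>' a * \<phi>' b) mod 7), monoid.one = \<phi> 1, ring.zero = \<phi> 0,
     ring.add = \<lambda>a b. \<phi> ((\<phi>' a + \<phi>' b) mod 7)\<rparr>"

text \<open>
  The multiplication and the unit belong to the record type of modules but have no meaning for a
  vector space.
\<close>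

definition V :: "('k, 'v) module" where
  "V = \<lparr>carrier = \<psi> ` F7_3, monoid.mult = \<lambda>u v. u, monoid.one = \<psi> (0, 0, 0),
     ring.zero = \<psi> (0, 0, 0),
     ring.add = \<lambda>u v. \<psi> (mod7 (plus3 (\<psi>' u) (\<psi>' v))),
     module.smult = \<lambda>c v. \<psi> (mod7 (scale (\<phi>' c) (\<psi>' v)))\<rparr>"

lemma \<phi>_eq [simp]: "\<phi> a = \<phi> b \<longleftrightarrow> a = b"
  by (metis \<phi>'_\<phi>)

lemma \<psi>_eq [simp]: "\<psi> u = \<psi> v \<longleftrightarrow> u = v"
  by (metis \<psi>'_\<psi>)

lemma field_K: "field K"
proof -
  interpret R: residues_prime 7 "residue_ring (int 7)"
    by unfold_locales simp_all
  have "\<phi> \<in> ring_iso (residue_ring 7) K"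
    by (auto simp: ring_iso_def ring_hom_def K_def residue_ring_def F7_def
        bij_betw_def inj_on_def)
  with R.is_field field.ring_iso_imp_img_field[of "residue_ring 7" \<phi> K] show ?thesis
    by (simp add: K_def residue_ring_def)
qed

lemma V_simps:
  "carrier V = \<psi> ` F7_3" "carrier K = \<phi> ` F7"
  "\<zero>\<^bsub>V\<^esub> = \<psi> (0, 0, 0)" "\<one>\<^bsub>K\<^esub> = \<phi> 1"
  "\<psi> u \<oplus>\<^bsub>V\<^esub> \<psi> v = \<psi> (mod7 (plus3 u v))" "\<phi> a \<odot>\<^bsub>V\<^esub> \<psi> v = \<psi> (mod7 (scale a v))"
  "\<phi> a \<oplus>\<^bsub>K\<^esub> \<phi> b = \<phi> ((a + b) mod 7)" "\<phi> a \<otimes>\<^bsub>K\<^esub> \<phi> b = \<phi> ((a * b) mod 7)"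
  by (simp_all add: K_def V_def)

lemma vectorspace_V: "vectorspace K V"
proof (rule vs_criteria[OF field_K])
  have "(0, 0, 0) \<in> F7_3" by (simp add: F7_def)
  then show "\<zero>\<^bsub>V\<^esub> \<in> carrier V" by (simp only: V_simps) (rule imageI)
  show "\<forall>v\<in>carrier V. \<exists>w\<in>carrier V. v \<oplus>\<^bsub>V\<^esub> w = \<zero>\<^bsub>V\<^esub>"
  proof
    fix v assume "v \<in> carrier V"
    then obtain x y z where "v = \<psi> (x, y, z)" by (auto simp: V_simps)
    then show "\<exists>w\<in>carrier V. v \<oplus>\<^bsub>V\<^esub> w = \<zero>\<^bsub>V\<^esub>"
      by (intro bexI[of _ "\<psi> (mod7 (- x, - y, - z))"]) (simp_all add: V_simps mod_simps)
  qed
qed (auto simp: V_simps mod_simps algebra_simps)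

lemma fin_dim_V: "vectorspace.fin_dim K V"
proof -
  interpret vectorspace K V by (rule vectorspace_V)
  have "finite (carrier V)" by (simp add: V_simps F7_def)
  moreover have "span (carrier V) = carrier V"
    using in_own_span[of "carrier V"] span_is_subset2[of "carrier V"] by auto
  ultimately show ?thesis by (auto simp: fin_dim_def)
qed

text \<open>The plane with normal vector \<open>n\<close>; it is all of \<open>V\<close> if \<open>n\<close> vanishes modulo 7.\<close>

definition plane :: "vec3 \<Rightarrow> 'v set" where
  "plane n = \<psi> ` {v \<in> F7_3. dot n v mod 7 = 0}"

lemma in_plane [simp]: "\<psi> v \<in> plane n \<longleftrightarrow> v \<in> F7_3 \<and> dot n v mod 7 = 0"
  by (auto simp: plane_def)

lemma subspace_plane: "VectorSpace.subspace K (plane n) V"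
proof -
  have "Module.module K V"
    using vectorspace_V by (simp add: vectorspace_def)
  then have "submodule K (plane n) V"
  proof (rule submodule.intro)
    fix u v assume "u \<in> plane n" "v \<in> plane n"
    then obtain u' v' where uv: "u = \<psi> u'" "v = \<psi> v'" "dot n u' mod 7 = 0" "dot n v' mod 7 = 0"
      by (auto simp: plane_def)
    then have "dot n (mod7 (plus3 u' v')) mod 7 = 0"
      by (simp add: dot_mod7 dot_plus3 mod_0_imp_dvd)
    then show "u \<oplus>\<^bsub>V\<^esub> v \<in> plane n"
      using uv by (simp add: V_simps del: mod7.simps)
  next
    fix c v assume "c \<in> carrier K" "v \<in> plane n"
    then obtain a v' where cv: "c = \<phi> a" "v = \<psi> v'" "dot n v' mod 7 = 0"
      by (auto simp: plane_def V_simps)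
    then have "dot n (mod7 (scale a v')) mod 7 = 0"
      by (auto simp add: dot_mod7 dot_scale mod_0_imp_dvd)
    then show "c \<odot>\<^bsub>V\<^esub> v \<in> plane n"
      using cv by (simp add: V_simps)
  next
    show "\<zero>\<^bsub>V\<^esub> \<in> plane n"
      by (cases n) (simp add: V_simps F7_def)
  qed (auto simp: plane_def V_simps)
  then show ?thesis
    using vectorspace_V by (simp add: VectorSpace.subspace_def)
qed

lemma hyperplane_plane:
  assumes "e \<in> F7_3" and "dot n e mod 7 = 1"
  shows "hyperplane K V (plane n)"
proof -
  have "dim_of K V (plane n) + 1 = vectorspace.dim K V"
  proof (rule dim_of_codim1[OF vectorspace_V fin_dim_V subspace_plane, of "\<psi> e"])
    show "\<psi> e \<in> carrier V" using assms by (simp add: V_simps)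
    show "\<psi> e \<notin> plane n" using assms by simp
    fix w assume "w \<in> carrier V"
    then obtain w' where w: "w = \<psi> w'" "w' \<in> F7_3" by (auto simp: V_simps)
    \<comment> \<open>Since \<open>n \<cdot> e = 1\<close>, subtracting \<open>n \<cdot> w\<close> times \<open>e\<close> from \<open>w\<close> leads into the plane.\<close>
    define a where "a = dot n w' mod 7"
    define u where "u = mod7 (plus3 w' (scale (- a) e))"
    have "[dot n w' - a * dot n e = dot n w' - dot n w' * 1] (mod 7)"
      using assms(2) unfolding a_def by (intro cong_diff cong_mult) (simp_all add: cong_def)
    then have "dot n u mod 7 = 0"
      by (simp add: u_def dot_mod7 dot_plus3 dot_scale cong_def)
    moreover have "u \<in> F7_3"
      by (simp add: u_def del: mod7.simps)
    ultimately have "\<psi> u \<in> plane n" by simp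
    moreover have "w = \<phi> a \<odot>\<^bsub>V\<^esub> \<psi> e \<oplus>\<^bsub>V\<^esub> \<psi> u"
      using w(2)
      by (cases w'; cases e) (simp add: w(1) V_simps u_def mod_simps algebra_simps F7_cancel)
    ultimately show "\<exists>c\<in>carrier K. \<exists>u\<in>plane n. w = c \<odot>\<^bsub>V\<^esub> \<psi> e \<oplus>\<^bsub>V\<^esub> u"
      by (intro bexI[of _ "\<phi> a"] bexI[of _ "\<psi> u"]) (simp_all add: V_simps a_def)
  qed
  then show ?thesis
    by (simp add: hyperplane_def subspace_plane dim_of_def)
qed

text \<open>
  Intersecting the three coordinate planes one after the other lowers the dimension by one each
  time and ends with the zero space.
\<close>

lemma dim_V: "vectorspace.dim K V = 3"
proof -
  let ?X = "plane (1, 0, 0)" and ?Y = "plane (0, 1, 0)" and ?Z = "plane (0, 0, 1)"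
  have hyp: "hyperplane K V ?X" "hyperplane K V ?Y" "hyperplane K V ?Z"
    by (rule hyperplane_plane[of "(1,0,0)"] hyperplane_plane[of "(0,1,0)"]
        hyperplane_plane[of "(0,0,1)"]; simp add: F7_def)+
  interpret vectorspace K V by (rule vectorspace_V)
  have sub: "VectorSpace.subspace K (?Y \<inter> ?X) V"
    by (rule subspace_Int[OF vectorspace_V subspace_plane subspace_plane])
  have "\<psi> (0, 1, 0) \<in> ?X" "\<psi> (0, 1, 0) \<notin> ?Y" "\<psi> (0, 0, 1) \<in> ?Y \<inter> ?X" "\<psi> (0, 0, 1) \<notin> ?Z"
    by (simp_all add: F7_def)
  then have "\<not> ?X \<subseteq> ?Y" "\<not> ?Y \<inter> ?X \<subseteq> ?Z"
    by blast+
  then have "dim_of K V (?Y \<inter> ?X) + 1 = dim_of K V ?X"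
    "dim_of K V (?Z \<inter> (?Y \<inter> ?X)) + 1 = dim_of K V (?Y \<inter> ?X)"
    using dim_of_Int_hyperplane[OF vectorspace_V fin_dim_V] hyp sub subspace_plane by blast+
  moreover have "dim_of K V ?X + 1 = dim"
    using hyp(1) by (simp add: hyperplane_def dim_of_def)
  moreover have "?Z \<inter> (?Y \<inter> ?X) = {\<zero>\<^bsub>V\<^esub>}"
    by (auto simp: plane_def V_simps)
  moreover have "dim_of K V {\<zero>\<^bsub>V\<^esub>} = 0"
  proof -
    have "VectorSpace.subspace K {\<zero>\<^bsub>V\<^esub>} V"
      using span_is_subspace[of "{}"] span_empty by simp
    from subspace_basis_exists[OF vectorspace_V fin_dim_V this]
    obtain B where B: "B \<subseteq> {\<zero>\<^bsub>V\<^esub>}" "lin_indpt B" "card B = dim_of K V {\<zero>\<^bsub>V\<^esub>}"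
      by metis
    then have "\<zero>\<^bsub>V\<^esub> \<notin> B"
      using vs_zero_lin_dep[of B] by auto
    then have "B = {}" using B(1) by auto
    then show ?thesis using B(3) by simp
  qed
  ultimately show ?thesis by simp
qed

end

section \<open>Arrangements given by normal vectors\<close>

text \<open>
  The vectors in \<open>S\<close> are normal vectors of pairwise distinct planes: no two of them have cross
  product zero modulo 7.  Each is required to have an entry congruent to 1, a normalization that
  supplies the vector \<open>e\<close> needed in \<open>hyperplane_plane\<close>.
\<close>

definition distinct_planes :: "vec3 set \<Rightarrow> bool" where
  "distinct_planes S \<longleftrightarrow> (\<forall>n\<in>S. (\<exists>e\<in>{(1,0,0), (0,1,0), (0,0,1)}. dot n e mod 7 = 1) \<and>
     (\<forall>m\<in>S. n \<noteq> m \<longrightarrow> mod7 (cross n m) \<noteq> (0, 0, 0)))"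

lemma distinct_planes_subset: "distinct_planes S \<Longrightarrow> T \<subseteq> S \<Longrightarrow> distinct_planes T"
  unfolding distinct_planes_def by blast

text \<open>
  The number of lines in which the planes with normals \<open>ms\<close> meet the plane with normal \<open>n\<close>
  (projectively: of points on a line), provided that all these planes differ from it.  Two planes
  \<open>m\<close>, \<open>m'\<close> meet it in the same line iff the determinant of \<open>n\<close>, \<open>m\<close>, \<open>m'\<close> vanishes.
\<close>

primrec points_on :: "vec3 \<Rightarrow> vec3 list \<Rightarrow> nat" where
  "points_on n [] = 0"
| "points_on n (m # ms) =
    (if \<exists>m'\<in>set ms. dot m' (cross n m) mod 7 = 0 then points_on n ms else Suc (points_on n ms))"

text \<open>
  The characteristic polynomial of a nonempty list of \<open>l\<close> planes, obtained by adding them one at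
  a time: the first plane gives \<open>t^3 - t^2\<close>, and each later plane, meeting the earlier ones in \<open>m\<close>
  lines, contributes \<open>-(t^2 - m t + (m - 1))\<close>.  Hence the linear coefficient \<open>b\<close> is the sum of
  these \<open>m\<close>, and the constant one is \<open>l - 1 - b\<close>.
\<close>

primrec chi_linear :: "vec3 list \<Rightarrow> nat" where
  "chi_linear [] = 0"
| "chi_linear (n # ms) = points_on n ms + chi_linear ms"

definition chi_poly :: "vec3 list \<Rightarrow> int poly" where
  "chi_poly ms = (let l = int (length ms); b = int (chi_linear ms) in [:l - 1 - b, b, - l, 1:])"

text \<open>
  The normals \<open>n\<close> for which one less than the number of lines on the plane of \<open>n\<close> is a root of
  the characteristic polynomial: only such a plane can be the last one in an inductive
  construction of an arrangement of at least two planes.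
\<close>

definition deletable :: "vec3 list \<Rightarrow> vec3 list" where
  "deletable ms = (let p = chi_poly ms in
     filter (\<lambda>n. poly p (int (points_on n (removeAll n ms)) - 1) = 0) ms)"

context F7_space begin

lemma plane_not_subset:
  assumes "mod7 (cross n m) \<noteq> (0, 0, 0)"
  shows "\<not> plane n \<subseteq> plane m"
proof -
  obtain a b c x y z where nm: "n = (a, b, c)" "m = (x, y, z)"
    by (cases n; cases m)
  \<comment> \<open>The vectors \<open>n \<times> e\<close> lie in the plane of \<open>n\<close>, and \<open>m \<cdot> (n \<times> e) = e \<cdot> (m \<times> n)\<close>.\<close>
  have "\<exists>e. dot m (cross n e) mod 7 \<noteq> 0"
  proof (rule ccontr)
    assume "\<nexists>e. dot m (cross n e) mod 7 \<noteq> 0"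
    then have "7 dvd dot m (cross n (1, 0, 0))" "7 dvd dot m (cross n (0, 1, 0))"
      "7 dvd dot m (cross n (0, 0, 1))"
      by (simp_all only: mod_eq_0_iff_dvd) blast+
    then have "7 dvd - (b * z - c * y)" "7 dvd - (c * x - a * z)" "7 dvd - (a * y - b * x)"
      by (simp_all add: nm algebra_simps)
    then have "7 dvd b * z - c * y" "7 dvd c * x - a * z" "7 dvd a * y - b * x"
      by (simp_all only: dvd_minus_iff)
    then show False
      using assms by (simp add: nm)
  qed
  then obtain e where "dot m (cross n e) mod 7 \<noteq> 0" by blast
  then have "\<psi> (mod7 (cross n e)) \<in> plane n - plane m"
    by (simp add: dot_mod7 dot_cross_self del: mod7.simps)
  then show ?thesis by blast
qed

lemma arrangement_planes:
  assumes "distinct_planes S" and "finite S"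
  shows "arrangement K 3 V (plane ` S)"
proof -
  have "hyperplane K V (plane n)" if n: "n \<in> S" for n
  proof -
    obtain e where "e \<in> {(1,0,0), (0,1,0), (0,0,1)}" "dot n e mod 7 = 1"
      using assms(1) n unfolding distinct_planes_def by blast
    then show ?thesis
      by (intro hyperplane_plane[of e]) auto
  qed
  then show ?thesis
    using assms vectorspace_V fin_dim_V dim_V by (auto simp: arrangement_def)
qed

lemma cross_neq_0:
  "distinct_planes S \<Longrightarrow> n \<in> S \<Longrightarrow> m \<in> S \<Longrightarrow> n \<noteq> m \<Longrightarrow> mod7 (cross n m) \<noteq> (0, 0, 0)"
  unfolding distinct_planes_def by blast

lemma inj_on_plane: "distinct_planes S \<Longrightarrow> inj_on plane S"
  by (intro inj_onI) (metis cross_neq_0 plane_not_subset subset_refl)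

lemma plane_Int_eq_iff:
  assumes dp: "distinct_planes {n, m, m'}" and "m \<noteq> n" "m' \<noteq> n"
  shows "plane m \<inter> plane n = plane m' \<inter> plane n \<longleftrightarrow> dot m' (cross n m) mod 7 = 0"
proof
  \<comment> \<open>\<open>n \<times> m\<close> spans the line in which the planes of \<open>n\<close> and \<open>m\<close> meet.\<close>
  define p where "p = \<psi> (mod7 (cross n m))"
  have p: "p \<in> plane m \<inter> plane n"
    by (simp add: p_def dot_mod7 dot_cross_self del: mod7.simps)
  have p_m': "p \<in> plane m' \<longleftrightarrow> dot m' (cross n m) mod 7 = 0"
    by (simp add: p_def dot_mod7 del: mod7.simps)
  show "dot m' (cross n m) mod 7 = 0" if "plane m \<inter> plane n = plane m' \<inter> plane n"
  proof -
    have "p \<in> plane m' \<inter> plane n"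
      using p that by simp
    then show ?thesis
      using p_m' by simp
  qed
  have p0: "p \<noteq> \<zero>\<^bsub>V\<^esub>"
    using cross_neq_0[OF dp, of n m] \<open>m \<noteq> n\<close> by (auto simp: p_def V_simps)
  have hyp: "hyperplane K V (plane k)" and dim2: "dim_of K V (plane k) = 2"
    if "k \<in> {n, m, m'}" for k
    using arrangement_planes[OF dp] arrangement_subspace(3)[OF arrangement_planes[OF dp]] that
    by (auto simp: arrangement_def)
  have sub: "VectorSpace.subspace K (plane k \<inter> plane n) V" for k
    by (intro subspace_Int vectorspace_V subspace_plane)
  have "\<not> plane n \<subseteq> plane k" if "k \<in> {m, m'}" for k
    using that assms(2,3) by (intro plane_not_subset cross_neq_0[OF dp]) auto
  then have dim1: "dim_of K V (plane k \<inter> plane n) = 1" if "k \<in> {m, m'}" for k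
    using dim_of_Int_hyperplane[OF vectorspace_V fin_dim_V hyp subspace_plane, of k n] that dim2[of n]
    by auto
  show "plane m \<inter> plane n = plane m' \<inter> plane n" if "dot m' (cross n m) mod 7 = 0"
  proof (rule subspace_eq_of_dim_eq[OF vectorspace_V fin_dim_V sub sub])
    have "plane m \<inter> plane n \<subseteq> plane m'"
    proof (rule ccontr)
      assume "\<not> plane m \<inter> plane n \<subseteq> plane m'"
      then have "dim_of K V (plane m' \<inter> (plane m \<inter> plane n)) = 0"
        using dim_of_Int_hyperplane[OF vectorspace_V fin_dim_V hyp sub, of m' m] dim1[of m] by auto
      then have "plane m' \<inter> (plane m \<inter> plane n) = {\<zero>\<^bsub>V\<^esub>}"
        by (rule subspace_dim_0[OF vectorspace_V fin_dim_V
              subspace_Int[OF vectorspace_V subspace_plane sub]])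
      moreover have "p \<in> plane m' \<inter> (plane m \<inter> plane n)"
        using p p_m' that by simp
      ultimately show False
        using p0 by simp
    qed
    then show "plane m \<inter> plane n \<subseteq> plane m' \<inter> plane n" by blast
  qed (simp add: dim1)
qed

lemma card_plane_Int:
  assumes "distinct_planes (insert n (set ms))" and "n \<notin> set ms"
  shows "card ((\<lambda>m. plane m \<inter> plane n) ` set ms) = points_on n ms"
  using assms
proof (induction ms)
  case (Cons m ms)
  have "plane m \<inter> plane n = plane m' \<inter> plane n \<longleftrightarrow> dot m' (cross n m) mod 7 = 0"
    if "m' \<in> set ms" for m'
    using Cons.prems that
    by (intro plane_Int_eq_iff distinct_planes_subset[OF Cons.prems(1)]) auto
  then have "plane m \<inter> plane n \<in> (\<lambda>m. plane m \<inter> plane n) ` set ms \<longleftrightarrow>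
      (\<exists>m'\<in>set ms. dot m' (cross n m) mod 7 = 0)"
    unfolding image_iff by (intro bex_cong refl)
  moreover have "card ((\<lambda>m. plane m \<inter> plane n) ` set ms) = points_on n ms"
    using Cons.prems by (intro Cons.IH distinct_planes_subset[OF Cons.prems(1)]) auto
  ultimately show ?case
    by (simp add: card_insert_if)
qed simp

lemma planes_Diff:
  assumes "distinct_planes S" and "n \<in> S"
  shows "plane ` S - {plane n} = plane ` (S - {n})"
  using inj_on_image_set_diff[OF inj_on_plane[OF assms(1)], of S "{n}"] assms(2) by simp

lemma restriction_planes:
  assumes "distinct_planes S" and "n \<in> S"
  shows "restriction (plane ` S) (plane n) = (\<lambda>m. plane m \<inter> plane n) ` (S - {n})"
  by (simp add: restriction_def planes_Diff[OF assms] image_image)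

lemma card_restriction_planes:
  assumes "distinct_planes (set ms)" and "n \<in> set ms"
  shows "card (restriction (plane ` set ms) (plane n)) = points_on n (removeAll n ms)"
  using card_plane_Int[of n "removeAll n ms"] assms
  by (simp add: restriction_planes insert_absorb)

lemma char_poly_planes:
  assumes "distinct_planes (set ms)" and "distinct ms" and "ms \<noteq> []"
  shows "char_poly_arr K V (plane ` set ms) = chi_poly ms"
  using assms
proof (induction ms)
  case (Cons n ms)
  show ?case
  proof (cases "ms = []")
    case True
    then show ?thesis
      using arrangement_planes[OF Cons.prems(1)]
      by (simp add: char_poly_singleton chi_poly_def monom_altdef numeral_eq_Suc)
  next
    case False
    let ?A = "plane ` set (n # ms)" and ?H = "plane n"
    have arr: "arrangement K 3 V ?A"
      using arrangement_planes[OF Cons.prems(1)] by simp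
    have rem: "removeAll n (n # ms) = ms"
      using Cons.prems by simp
    have card: "card (restriction ?A ?H) = points_on n ms"
      using card_restriction_planes[OF Cons.prems(1), of n] rem by simp
    have "restriction ?A ?H \<noteq> {}"
      using restriction_planes[OF Cons.prems(1), of n] Cons.prems False by auto
    then have "char_poly_arr K (V\<lparr>carrier := ?H\<rparr>) (restriction ?A ?H) =
        [:int (points_on n ms) - 1, - int (points_on n ms), 1:]"
      using char_poly_dim3_restriction[OF arr, of ?H] card by simp
    moreover have "char_poly_arr K V (?A - {?H}) = chi_poly ms"
      using planes_Diff[OF Cons.prems(1), of n] rem Cons.prems False
        Cons.IH[OF distinct_planes_subset[OF Cons.prems(1)]] by auto
    ultimately show ?thesis
      using char_poly_deletion_restriction[OF arr, of ?H] by (simp add: chi_poly_def Let_def)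
  qed
qed simp

lemma inductively_free_planes_deletable:
  assumes "distinct_planes (set ms)" and "distinct ms" and "length ms \<ge> 2"
    and "inductively_free K 3 V (plane ` set ms)"
  obtains n where "n \<in> set (deletable ms)"
    and "inductively_free K 3 V (plane ` set (removeAll n ms))"
proof -
  have "card (plane ` set ms) = card (set ms)"
    by (rule card_image[OF inj_on_plane[OF assms(1)]])
  then have "card (plane ` set ms) \<ge> 2"
    using assms(2,3) by (simp add: distinct_card)
  from inductively_free_dim3_root[OF assms(4) this] obtain H where H: "H \<in> plane ` set ms"
      "inductively_free K 3 V (plane ` set ms - {H})"
      "poly (char_poly_arr K V (plane ` set ms))
        (int (card (restriction (plane ` set ms) H)) - 1) = 0"
    by metis
  then obtain n where n: "n \<in> set ms" "H = plane n"
    by blast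
  have "ms \<noteq> []" using assms(3) by auto
  show thesis
  proof (rule that)
    show "n \<in> set (deletable ms)"
      using H(3) n char_poly_planes[OF assms(1,2) \<open>ms \<noteq> []\<close>]
        card_restriction_planes[OF assms(1) n(1)]
      by (simp add: deletable_def Let_def)
    show "inductively_free K 3 V (plane ` set (removeAll n ms))"
      using H(2) n planes_Diff[OF assms(1) n(1)] by simp
  qed
qed

end

section \<open>A divisionally free arrangement that is not inductively free\<close>

text \<open>
  An arrangement of 16 planes with characteristic polynomial \<open>(t - 1)(t - 7)(t - 8)\<close>.  Two of
  them, those with normals \<open>(0,0,1)\<close> and \<open>(0,1,2)\<close>, contain eight intersection lines, all others
  at most seven.  The normals come from a computer search over small fields.
\<close>

definition normals :: "vec3 list" where
  "normals = [(0,0,1), (0,1,2), (1,0,2), (1,1,0), (1,1,1), (1,1,5), (1,1,6), (1,2,2),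
    (1,2,3), (1,3,6), (1,4,0), (1,5,5), (1,6,3), (1,6,4), (1,6,5), (1,6,6)]"

lemma normals_distinct: "distinct_planes (set normals)" "distinct normals"
  by code_simp+

lemma chi_poly_normals: "chi_poly normals = [:-56, 71, -16, 1:]"
  by code_simp

lemma points_on_normals: "points_on (0,0,1) (removeAll (0,0,1) normals) = 8"
  by code_simp

text \<open>
  Deleting one of the two planes leaves the characteristic polynomial \<open>(t - 1)(t - 7)^2\<close>, but no
  plane with eight intersection lines.
\<close>

lemma deletable_normals:
  "deletable normals = [(0,0,1), (0,1,2)]"
  "deletable (removeAll (0,0,1) normals) = []"
  "deletable (removeAll (0,1,2) normals) = []"
  by code_simp+

context F7_space begin

theorem not_inductively_free_normals: "\<not> inductively_free K l V (plane ` set normals)"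
proof
  assume IF: "inductively_free K l V (plane ` set normals)"
  then have "l = 3"
    using inductively_free_arrangement dim_V by (auto simp: arrangement_def)
  have len: "length normals \<ge> 2" "length (removeAll (0,0,1) normals) \<ge> 2"
      "length (removeAll (0,1,2) normals) \<ge> 2"
    by (simp_all add: normals_def)
  obtain n where n: "n \<in> set (deletable normals)"
      "inductively_free K 3 V (plane ` set (removeAll n normals))"
    by (rule inductively_free_planes_deletable[OF normals_distinct len(1)
          IF[unfolded \<open>l = 3\<close>]])
  have "n = (0,0,1) \<or> n = (0,1,2)"
    using n(1) by (simp add: deletable_normals)
  then have del: "deletable (removeAll n normals) = []" "length (removeAll n normals) \<ge> 2"
    using deletable_normals len by auto
  have "distinct_planes (set (removeAll n normals))"
    by (rule distinct_planes_subset[OF normals_distinct(1)]) auto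
  moreover have "distinct (removeAll n normals)"
    by (rule distinct_removeAll[OF normals_distinct(2)])
  ultimately obtain m where "m \<in> set (deletable (removeAll n normals))"
    by (rule inductively_free_planes_deletable[OF _ _ del(2) n(2)])
  then show False
    by (simp add: del(1))
qed

theorem divisionally_free_normals: "divisionally_free K 3 V (plane ` set normals)"
proof -
  let ?A = "plane ` set normals" and ?n = "(0, 0, 1)"
  let ?VH = "V\<lparr>carrier := plane ?n\<rparr>"
  have arr: "arrangement K 3 V ?A"
    by (rule arrangement_planes[OF normals_distinct(1)]) simp
  have n: "?n \<in> set normals"
    by (simp add: normals_def)
  have card: "card (restriction ?A (plane ?n)) = 8"
    using card_restriction_planes[OF normals_distinct(1) n] points_on_normals by (simp only:)
  then have "restriction ?A (plane ?n) \<noteq> {}"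
    by (metis card.empty numeral_neq_zero)
  then have "char_poly_arr K ?VH (restriction ?A (plane ?n)) = [:7, -8, 1:]"
    using char_poly_dim3_restriction[OF arr imageI[OF n]] card by simp
  moreover have "char_poly_arr K V ?A = [:-56, 71, -16, 1:]"
    using char_poly_planes[OF normals_distinct] chi_poly_normals
    by (metis list.distinct(1) normals_def)
  moreover have "[:-56, 71, -16, 1:] = [:7, -8, 1:] * [:-8, 1 :: int:]"
    by simp
  ultimately have "char_poly_arr K ?VH (restriction ?A (plane ?n)) dvd char_poly_arr K V ?A"
    by (metis dvd_triv_left)
  moreover have "divisionally_free K 2 ?VH (restriction ?A (plane ?n))"
    using arrangement_restriction[OF arr imageI[OF n]] by (intro divisionally_free.low_dim) simp_all
  ultimately show ?thesis
    by (intro divisionally_free.step[OF arr _ imageI[OF n]]) simp_all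
qed

end

lemma inj_countable_infinite:
  assumes "infinite (UNIV :: 'b set)"
  obtains f :: "'a :: countable \<Rightarrow> 'b" where "inj f"
proof -
  obtain g :: "nat \<Rightarrow> 'b" where "inj g"
    using infinite_countable_subset[OF assms] by auto
  then have "inj (g \<circ> to_nat :: 'a \<Rightarrow> 'b)"
    by (intro inj_compose inj_to_nat)
  then show thesis by (rule that)
qed

theorem theorem1p6:
  shows "(IF :: ('k ring \<times> ('k, 'v) module \<times> 'v set set) set) \<subseteq> DF
    \<and> (infinite (UNIV :: 'k set) \<and> infinite (UNIV :: 'v set) \<longrightarrow>
         (IF :: ('k ring \<times> ('k, 'v) module \<times> 'v set set) set) \<subset> DF)"
proof (intro conjI impI IF_subset_DF)
  assume inf: "infinite (UNIV :: 'k set) \<and> infinite (UNIV :: 'v set)"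
  obtain \<phi> :: "int \<Rightarrow> 'k" where \<phi>: "inj \<phi>"
    using inj_countable_infinite inf by blast
  obtain \<psi> :: "vec3 \<Rightarrow> 'v" where \<psi>: "inj \<psi>"
    using inj_countable_infinite inf by blast
  interpret F7_space \<phi> "inv_into UNIV \<phi>" \<psi> "inv_into UNIV \<psi>"
    using \<phi> \<psi> by unfold_locales simp_all
  have "(K, V, plane ` set normals) \<in> DF - IF"
    using divisionally_free_normals not_inductively_free_normals by (auto simp: IF_def DF_def intro!: exI[of _ 3])
  then show "(IF :: ('k ring \<times> ('k, 'v) module \<times> 'v set set) set) \<subset> DF"
    using IF_subset_DF by blast
qed

end
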